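(* Let $V$ be a rank one valuation domain with quotient field $K$ and valuation $v$. Let $E=\{s_n\}_{n\in\mathbb{N}}\subset K$ be a pseudo-convergent sequence with non-zero breadth ideal such that $V_E$ has rank $2$. Then the map $$\nu\colon K(X)\setminus\{0\}\longrightarrow\mathbb{R}^2,\qquad \phi\longmapsto(w_E(\phi),-\mathrm{degdom}_E(\phi)),$$ where $\mathbb{R}^2$ is endowed with the lexicographic order, is a valuation on $K(X)$ whose associated valuation ring is $V_E$.
   Context: $V$ has rank one and its value group is regarded as a subgroup of $\mathbb{R}$; $\overline{K}$ is an algebraic closure of $K$. A sequence $E=\{s_n\}_{n\in\mathbb{N}}$ in $K$ is pseudo-convergent if $v(s_{n+1}-s_n)<v(s_{n+2}-s_{n+1})$ for all $n$. Its breadth ideal is $\mathrm{Br}(E)=\{b\in K\mid v(b)>v(s_{n+1}-s_n)\ \forall n\in\mathbb{N}\}$. $V_E=\{\phi\in K(X)\mid \phi(s_n)\in V\text{ for all but finitely many }n\in\mathbb{N}\}$, a valuation domain of $K(X)$ lying over $V$. For $\phi\in K(X)$, $w_E(\phi)=\lim_{n\to\infty}v(\phi(s_n))$; since $\mathrm{Br}(E)\neq(0)$, this limit exists in $\mathbb{R}$ for $\phi\neq 0$ and $w_E$ is a rank one valuation on $K(X)$ extending $v$. Dominating degree: let $u$ be an extension of $v$ to $\overline{K}$. An element $\alpha\in\overline{K}$ is a pseudo-limit of $E$ with respect to $u$ if $u(\alpha-s_n)<u(\alpha-s_{n+1})$ for all $n$. For $0\neq\phi\in K(X)$, $\mathrm{degdom}_E(\phi)\in\mathbb{Z}$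 is the number of zeros of $\phi$ in $\overline{K}$ that are pseudo-limits of $E$ with respect to $u$, minus the number of poles of $\phi$ in $\overline{K}$ that are pseudo-limits of $E$ with respect to $u$ (all counted with multiplicity); this integer does not depend on the choice of $u$. *)

theory Defs
  imports
    Complex_Main
    "HOL-Library.Extended_Nat"
    "HOL-Library.Product_Plus"
    "HOL-Library.Product_Lexorder"
    "HOL-Algebra.Algebraic_Closure_Type"
begin

instance prod :: (linordered_ab_group_add, linordered_ab_group_add) linordered_ab_group_add
  by standard auto

text \<open>
  A valuation on a field is given by its values on nonzero elements; the convention that
  zero has value infinity is made explicit in the definitions below, and no
  definition uses the value of the function at zero, except in limits, where it affects
  only finitely many terms.
\<close>

definition valuation :: "('f::field \<Rightarrow> 'g::linordered_ab_group_add) \<Rightarrow> bool" where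
  "valuation v \<longleftrightarrow>
     (\<forall>x y. x \<noteq> 0 \<longrightarrow> y \<noteq> 0 \<longrightarrow> v (x * y) = v x + v y) \<and>
     (\<forall>x y. x \<noteq> 0 \<longrightarrow> y \<noteq> 0 \<longrightarrow> x + y \<noteq> 0 \<longrightarrow> min (v x) (v y) \<le> v (x + y))"

definition valuation_ring :: "('f::field \<Rightarrow> 'g::linordered_ab_group_add) \<Rightarrow> 'f set" where
  "valuation_ring v = {x. x = 0 \<or> 0 \<le> v x}"

text \<open>The relation ``\<open>v x < v y\<close>'' with zero having value infinity.\<close>

definition val_less :: "('f::field \<Rightarrow> 'g::linordered_ab_group_add) \<Rightarrow> 'f \<Rightarrow> 'f \<Rightarrow> bool" where
  "val_less v x y \<longleftrightarrow> x \<noteq> 0 \<and> (y = 0 \<or> v x < v y)"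

definition krull_dim :: "('r, 'm) ring_scheme \<Rightarrow> enat" where
  "krull_dim R = Sup {enat n | n. \<exists>P :: nat \<Rightarrow> 'r set.
     (\<forall>i\<le>n. primeideal (P i) R) \<and> (\<forall>i<n. P i \<subset> P (Suc i))}"

text \<open>The rank of a valuation domain, given as a subring of a field, is its Krull dimension.\<close>

definition val_rank :: "'f::field set \<Rightarrow> enat" where
  "val_rank A = krull_dim (ring_of_type_algebra\<lparr>carrier := A\<rparr>)"

definition pseudo_convergent :: "('a::field \<Rightarrow> real) \<Rightarrow> (nat \<Rightarrow> 'a) \<Rightarrow> bool" where
  "pseudo_convergent v s \<longleftrightarrow>
     (\<forall>n. val_less v (s (n + 1) - s n) (s (n + 2) - s (n + 1)))"

definition breadth_ideal :: "('a::field \<Rightarrow> real) \<Rightarrow> (nat \<Rightarrow> 'a) \<Rightarrow> 'a set" where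
  "breadth_ideal v s = {b. \<forall>n. val_less v (s (n + 1) - s n) b}"

text \<open>
  The field \<open>K(X)\<close> is \<open>'a poly fract\<close>. Each of its elements has exactly one
  representation in lowest terms with monic denominator.
\<close>

definition lowest_terms :: "'a::field poly fract \<Rightarrow> 'a poly \<times> 'a poly" where
  "lowest_terms \<phi> = (SOME (p, q). \<phi> = Fraction_Field.Fract p q \<and> coprime p q \<and>
     Polynomial.lead_coeff q = 1)"

definition numer :: "'a::field poly fract \<Rightarrow> 'a poly" where
  "numer \<phi> = fst (lowest_terms \<phi>)"

definition denom :: "'a::field poly fract \<Rightarrow> 'a poly" where
  "denom \<phi> = snd (lowest_terms \<phi>)"

definition ratfun_eval :: "'a::field poly fract \<Rightarrow> 'a \<Rightarrow> 'a" where
  "ratfun_eval \<phi> x = poly (numer \<phi>) x / poly (denom \<phi>) x"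

definition V_E :: "'a::field set \<Rightarrow> (nat \<Rightarrow> 'a) \<Rightarrow> 'a poly fract set" where
  "V_E V s = {\<phi>. \<forall>\<^sub>F n in sequentially.
     poly (denom \<phi>) (s n) \<noteq> 0 \<and> ratfun_eval \<phi> (s n) \<in> V}"

definition w_E :: "('a::field \<Rightarrow> real) \<Rightarrow> (nat \<Rightarrow> 'a) \<Rightarrow> 'a poly fract \<Rightarrow> real" where
  "w_E v s \<phi> = lim (\<lambda>n. v (ratfun_eval \<phi> (s n)))"

definition extends_to_closure ::
  "('a::field \<Rightarrow> real) \<Rightarrow> ('a alg_closure \<Rightarrow> real) \<Rightarrow> bool" where
  "extends_to_closure v u \<longleftrightarrow> valuation u \<and> (\<forall>x. x \<noteq> 0 \<longrightarrow> u (to_ac x) = v x)"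

definition pseudo_limit ::
  "('a::field alg_closure \<Rightarrow> real) \<Rightarrow> (nat \<Rightarrow> 'a) \<Rightarrow> 'a alg_closure \<Rightarrow> bool" where
  "pseudo_limit u s \<alpha> \<longleftrightarrow> (\<forall>n. val_less u (\<alpha> - to_ac (s n)) (\<alpha> - to_ac (s (n + 1))))"

text \<open>The number of roots, with multiplicity, of a nonzero polynomial that are pseudo-limits.\<close>

definition pseudo_limit_roots ::
  "('a::field alg_closure \<Rightarrow> real) \<Rightarrow> (nat \<Rightarrow> 'a) \<Rightarrow> 'a poly \<Rightarrow> nat" where
  "pseudo_limit_roots u s p =
     (\<Sum>\<alpha> | poly (map_poly to_ac p) \<alpha> = 0 \<and> pseudo_limit u s \<alpha>.
        Polynomial.order \<alpha> (map_poly to_ac p))"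

definition degdom ::
  "('a::field alg_closure \<Rightarrow> real) \<Rightarrow> (nat \<Rightarrow> 'a) \<Rightarrow> 'a poly fract \<Rightarrow> int" where
  "degdom u s \<phi> =
     int (pseudo_limit_roots u s (numer \<phi>)) - int (pseudo_limit_roots u s (denom \<phi>))"

end

theory Submission
  imports Defs
begin

text \<open>
  Put \<open>\<delta> n = v (s (n + 1) - s n)\<close>. For \<open>\<alpha>\<close> in the algebraic closure, \<open>u (s n - \<alpha>)\<close> equals
  \<open>\<delta> n\<close> for all \<open>n\<close> if \<open>\<alpha>\<close> is a pseudo-limit and is eventually constant otherwise. Splitting into
  linear factors, \<open>v (\<phi> (s n)) = degdom \<phi> * \<delta> n + c\<close> for almost all \<open>n\<close>. As the breadth ideal is
  nonzero, \<open>\<delta>\<close> increases strictly to a real limit, so comparing such affine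
  functions of \<open>\<delta> n\<close> for large \<open>n\<close> amounts to comparing the pairs (limit, negated slope)
  lexicographically.
\<close>

section \<open>Elementary properties of valuations\<close>

lemma valuation_mult:
  "valuation v \<Longrightarrow> x \<noteq> 0 \<Longrightarrow> y \<noteq> 0 \<Longrightarrow> v (x * y) = v x + v y"
  by (simp add: valuation_def)

lemma valuation_add:
  "valuation v \<Longrightarrow> x \<noteq> 0 \<Longrightarrow> y \<noteq> 0 \<Longrightarrow> x + y \<noteq> 0 \<Longrightarrow> min (v x) (v y) \<le> v (x + y)"
  by (simp add: valuation_def)

text \<open>Both \<open>v 1\<close> and twice \<open>v (-1)\<close> vanish, and a linearly ordered
  group is torsion-free.\<close>

lemma valuation_minus:
  assumes "valuation v" "x \<noteq> 0"
  shows "v (- x) = v x"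
proof -
  have "v 1 = v 1 + v 1"
    using valuation_mult[OF assms(1), of 1 1] by simp
  moreover have "v 1 = v (-1) + v (-1)"
    using valuation_mult[OF assms(1), of "-1" "-1"] by simp
  ultimately have "v (-1) = 0"
    by simp
  then show ?thesis
    using valuation_mult[OF assms(1), of "-1" x] assms(2) by simp
qed

lemma valuation_divide:
  assumes "valuation v" "x \<noteq> 0" "y \<noteq> 0"
  shows "v (x / y) = v x - v y"
  using valuation_mult[OF assms(1), of "x / y" y] assms(2,3) by (simp add: eq_diff_eq)

text \<open>The ultrametric inequality is an equality when the values differ; the convention in
  \<open>val_less\<close> covers \<open>y = 0\<close> as well.\<close>

lemma val_less_add:
  assumes "valuation v" "val_less v x y"
  shows "x + y \<noteq> 0" "v (x + y) = v x"
proof -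
  have x: "x \<noteq> 0" and y: "y = 0 \<or> v x < v y"
    using assms(2) by (auto simp: val_less_def)
  have "x + y \<noteq> 0 \<and> v (x + y) = v x"
  proof (cases "y = 0")
    case False
    with y have lt: "v x < v y" by simp
    have my: "v (- y) = v y"
      using valuation_minus[OF assms(1) False] .
    have nz: "x + y \<noteq> 0"
      using lt my by (auto simp: add_eq_0_iff2)
    \<comment> \<open>Here \<open>x\<close> is recovered as \<open>(x + y) + (- y)\<close>. Since
      \<open>v (- y)\<close> exceeds \<open>v x\<close>, the minimum must be
      \<open>v (x + y)\<close>.\<close>
    have "min (v (x + y)) (v (- y)) \<le> v (x + y + - y)"
      by (rule valuation_add[OF assms(1)]) (use nz False x in auto)
    then have "v (x + y) \<le> v x"
      using lt my by (auto simp: min_def split: if_splits)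
    moreover have "min (v x) (v y) \<le> v (x + y)"
      using valuation_add[OF assms(1) x False nz] .
    ultimately show ?thesis
      using nz lt by auto
  qed (use x in auto)
  then show "x + y \<noteq> 0" "v (x + y) = v x" by auto
qed

section \<open>Lowest terms and evaluation of rational functions\<close>

text \<open>A representation whose denominator has least degree is coprime, because cancelling a
  non-unit common factor would lower that degree. Scaling by a constant then makes the denominator
  monic.\<close>

lemma lowest_terms_exists:
  fixes \<phi> :: "'a::field poly fract"
  shows "\<exists>p q. \<phi> = Fraction_Field.Fract p q \<and> coprime p q \<and> Polynomial.lead_coeff q = 1"
proof -
  let ?P = "\<lambda>n. \<exists>p q. \<phi> = Fraction_Field.Fract p q \<and> q \<noteq> 0 \<and> Polynomial.degree q = n"
  obtain p\<^sub>0 q\<^sub>0 where "\<phi> = Fraction_Field.Fract p\<^sub>0 q\<^sub>0" "q\<^sub>0 \<noteq> 0"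
    by (rule Fract_cases)
  then have "?P (Polynomial.degree q\<^sub>0)"
    by blast
  then have "?P (LEAST n. ?P n)"
    by (rule LeastI)
  then obtain p q where pq: "\<phi> = Fraction_Field.Fract p q" "q \<noteq> 0"
    and deg: "Polynomial.degree q = (LEAST n. ?P n)"
    by blast
  have least: "Polynomial.degree q \<le> m" if "?P m" for m
    unfolding deg using that by (rule Least_le)
  have "coprime p q"
  proof (rule coprimeI)
    fix c assume "c dvd p" "c dvd q"
    then obtain p' q' where c: "p = c * p'" "q = c * q'"
      by (auto elim!: dvdE)
    have nz: "c \<noteq> 0" "q' \<noteq> 0"
      using pq(2) c(2) by auto
    have "\<phi> = Fraction_Field.Fract p' q'"
      unfolding pq(1) c using nz by (simp add: eq_fract)
    then have "Polynomial.degree q \<le> Polynomial.degree q'"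
      using least nz by blast
    then have "Polynomial.degree c = 0"
      using nz by (simp add: c degree_mult_eq)
    then show "is_unit c"
      using nz by (simp add: is_unit_iff_degree)
  qed
  define a where "a = inverse (Polynomial.lead_coeff q)"
  have a: "a \<noteq> 0"
    using pq(2) by (simp add: a_def)
  have "\<phi> = Fraction_Field.Fract (Polynomial.smult a p) (Polynomial.smult a q)"
    using a pq by (simp add: eq_fract)
  moreover have "coprime (Polynomial.smult a p) (Polynomial.smult a q)"
    using \<open>coprime p q\<close> a unfolding coprime_def by (simp add: dvd_smult_iff)
  moreover have "Polynomial.lead_coeff (Polynomial.smult a q) = 1"
    using pq(2) by (simp add: a_def)
  ultimately show ?thesis by blast
qed

lemma
  fixes \<phi> :: "'a::field poly fract"
  shows Fract_numer_denom: "Fraction_Field.Fract (numer \<phi>) (denom \<phi>) = \<phi>"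
    and denom_nonzero: "denom \<phi> \<noteq> 0"
proof -
  have "\<exists>x. (case x of (p, q) \<Rightarrow> \<phi> = Fraction_Field.Fract p q \<and> coprime p q \<and>
      Polynomial.lead_coeff q = 1)"
    using lowest_terms_exists[of \<phi>] by simp
  from someI_ex[OF this] show "Fraction_Field.Fract (numer \<phi>) (denom \<phi>) = \<phi>" "denom \<phi> \<noteq> 0"
    by (auto simp: lowest_terms_def[symmetric] numer_def denom_def split: prod.splits)
qed

lemma numer_eq_0_iff: "numer \<phi> = 0 \<longleftrightarrow> \<phi> = 0"
proof -
  have "Fraction_Field.Fract (numer \<phi>) (denom \<phi>) = 0 \<longleftrightarrow> numer \<phi> = 0"
    using denom_nonzero[of \<phi>] by (simp add: Zero_fract_def eq_fract)
  then show ?thesis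
    by (simp add: Fract_numer_denom)
qed

text \<open>Cross-multiplying \<open>p / q\<close> with the lowest-terms representation gives a
  polynomial identity, which is evaluated at \<open>x\<close> and divided by both
  denominators.\<close>

lemma ratfun_eval_Fract:
  assumes "poly q x \<noteq> 0" "poly (denom (Fraction_Field.Fract p q)) x \<noteq> 0"
  shows "ratfun_eval (Fraction_Field.Fract p q) x = poly p x / poly q x"
proof -
  let ?\<phi> = "Fraction_Field.Fract p q"
  have "q \<noteq> 0"
    using assms by auto
  then have "numer ?\<phi> * q = p * denom ?\<phi>"
    using Fract_numer_denom[of ?\<phi>] denom_nonzero[of ?\<phi>] by (simp add: eq_fract)
  then have "poly (numer ?\<phi>) x * poly q x = poly p x * poly (denom ?\<phi>) x"
    by (metis poly_mult)
  then show ?thesis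
    using assms by (simp add: ratfun_eval_def frac_eq_eq)
qed

text \<open>The obvious fractions for the product and the sum may fail to be in lowest terms, so
  \<open>ratfun_eval_Fract\<close> is applied to them.\<close>

lemma
  assumes "poly (denom \<phi>) x \<noteq> 0" "poly (denom \<psi>) x \<noteq> 0"
  shows ratfun_eval_mult: "poly (denom (\<phi> * \<psi>)) x \<noteq> 0 \<Longrightarrow>
      ratfun_eval (\<phi> * \<psi>) x = ratfun_eval \<phi> x * ratfun_eval \<psi> x"
    and ratfun_eval_add: "poly (denom (\<phi> + \<psi>)) x \<noteq> 0 \<Longrightarrow>
      ratfun_eval (\<phi> + \<psi>) x = ratfun_eval \<phi> x + ratfun_eval \<psi> x"
proof -
  have "\<phi> * \<psi> = Fraction_Field.Fract (numer \<phi> * numer \<psi>) (denom \<phi> * denom \<psi>)"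
    by (metis Fract_numer_denom mult_fract)
  moreover have "\<phi> + \<psi> =
      Fraction_Field.Fract (numer \<phi> * denom \<psi> + numer \<psi> * denom \<phi>) (denom \<phi> * denom \<psi>)"
    by (metis Fract_numer_denom add_fract denom_nonzero)
  ultimately show "poly (denom (\<phi> * \<psi>)) x \<noteq> 0 \<Longrightarrow>
      ratfun_eval (\<phi> * \<psi>) x = ratfun_eval \<phi> x * ratfun_eval \<psi> x"
    and "poly (denom (\<phi> + \<psi>)) x \<noteq> 0 \<Longrightarrow>
      ratfun_eval (\<phi> + \<psi>) x = ratfun_eval \<phi> x + ratfun_eval \<psi> x"
    using assms
    by (simp_all add: ratfun_eval_Fract ratfun_eval_def[of \<phi>] ratfun_eval_def[of \<psi>] add_frac_eq)
qed

section \<open>Passage to the algebraic closure\<close>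

lemma map_poly_to_ac_eq_0_iff [simp]: "map_poly to_ac p = 0 \<longleftrightarrow> p = 0"
  by (rule map_poly_eq_0_iff) auto

lemma poly_map_poly_to_ac: "poly (map_poly to_ac p) (to_ac x) = to_ac (poly p x)"
  by (induction p) (auto simp: map_poly_pCons)

text \<open>The multiset form makes the count additive when a linear factor is split off.\<close>

lemma pseudo_limit_roots_eq_size:
  assumes "p \<noteq> 0"
  shows "pseudo_limit_roots u s p =
    size (filter_mset (pseudo_limit u s) (proots (map_poly to_ac p)))"
  unfolding pseudo_limit_roots_def size_multiset_overloaded_eq
  using assms by (intro sum.cong) auto

section \<open>Eventual comparison of affine functions along a strictly increasing convergent
  sequence\<close>

text \<open>The limit \<open>e * L + c\<close> decides the sign if it is nonzero. If it vanishes,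
  the function is \<open>- e * (L - d n)\<close> with \<open>d n < L\<close> strictly, so the sign
  of \<open>- e\<close> decides.\<close>

lemma eventually_affine_nonneg_iff:
  fixes d :: "nat \<Rightarrow> real"
  assumes "strict_mono d" "d \<longlonglongrightarrow> L"
  shows "(\<forall>\<^sub>F n in sequentially. 0 \<le> e * d n + c) \<longleftrightarrow> 0 \<le> (e * L + c, - e)"
proof -
  have lim: "(\<lambda>n. e * d n + c) \<longlonglongrightarrow> e * L + c"
    by (intro tendsto_intros assms)
  have less: "d n < L" for n
  proof -
    have "d n < d (Suc n)"
      using assms(1) by (simp add: strict_mono_def)
    also have "d (Suc n) \<le> L"
      using assms by (intro incseq_le) (auto intro: strict_mono_mono)
    finally show ?thesis .
  qed
  consider "e * L + c > 0" | "e * L + c < 0" | "e * L + c = 0"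
    by linarith
  then show ?thesis
  proof cases
    case 1
    then show ?thesis
      using order_tendstoD(1)[OF lim 1] by (auto simp: zero_prod_def elim: eventually_mono)
  next
    case 2
    then have "\<not> (\<forall>\<^sub>F n in sequentially. 0 \<le> e * d n + c)"
      using tendsto_lowerbound[OF lim] by force
    with 2 show ?thesis
      by (auto simp: zero_prod_def)
  next
    case 3
    have "0 \<le> e * d n + c \<longleftrightarrow> e \<le> 0" for n
    proof -
      have "e * d n + c = - e * (L - d n)"
        using 3 by (simp add: algebra_simps)
      then show ?thesis
        using less[of n] by (simp add: mult_le_0_iff zero_le_mult_iff)
    qed
    with 3 show ?thesis
      by (auto simp: zero_prod_def)
  qed
qed

lemma eventually_affine_le_iff:
  fixes d :: "nat \<Rightarrow> real"
  assumes "strict_mono d" "d \<longlonglongrightarrow> L"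
  shows "(\<forall>\<^sub>F n in sequentially. e * d n + c \<le> e' * d n + c') \<longleftrightarrow>
    (e * L + c, - e) \<le> (e' * L + c', - e')"
  using eventually_affine_nonneg_iff[OF assms, of "e' - e" "c' - c"]
  by (simp add: zero_prod_def algebra_simps)

section \<open>The gauge of the sequence\<close>

locale bounded_pseudo_convergent =
  fixes v :: "'a::field \<Rightarrow> real" and u :: "'a alg_closure \<Rightarrow> real" and s :: "nat \<Rightarrow> 'a"
  assumes u_extends: "extends_to_closure v u"
    and s_pseudo_convergent: "pseudo_convergent v s"
    and breadth_nonzero: "breadth_ideal v s \<noteq> {0}"
begin

text \<open>This is the sequence \<delta> of the overview, known as the gauge of the
  pseudo-convergent sequence.\<close>

definition gauge :: "nat \<Rightarrow> real" where
  "gauge n = v (s (Suc n) - s n)"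

lemma u_valuation: "valuation u"
  using u_extends by (simp add: extends_to_closure_def)

lemma u_to_ac: "x \<noteq> 0 \<Longrightarrow> u (to_ac x) = v x"
  using u_extends by (simp add: extends_to_closure_def)

text \<open>The laws for \<open>v\<close> are inherited from \<open>u\<close> along the embedding
  \<open>to_ac\<close>.\<close>

lemma v_mult: "x \<noteq> 0 \<Longrightarrow> y \<noteq> 0 \<Longrightarrow> v (x * y) = v x + v y"
  using valuation_mult[OF u_valuation, of "to_ac x" "to_ac y"] u_to_ac[of "x * y"]
  by (simp add: u_to_ac)

lemma v_add:
  "x \<noteq> 0 \<Longrightarrow> y \<noteq> 0 \<Longrightarrow> x + y \<noteq> 0 \<Longrightarrow> min (v x) (v y) \<le> v (x + y)"
  using valuation_add[OF u_valuation, of "to_ac x" "to_ac y"] u_to_ac[of "x + y"]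
  by (simp add: u_to_ac flip: to_ac_add)

lemma v_divide: "x \<noteq> 0 \<Longrightarrow> y \<noteq> 0 \<Longrightarrow> v (x / y) = v x - v y"
  using valuation_divide[OF u_valuation, of "to_ac x" "to_ac y"] u_to_ac[of "x / y"]
  by (simp add: u_to_ac)

lemma s_Suc_neq: "s (Suc n) \<noteq> s n"
  using s_pseudo_convergent by (auto simp: pseudo_convergent_def val_less_def)

lemma gauge_Suc: "gauge n < gauge (Suc n)"
  using s_pseudo_convergent s_Suc_neq by (auto simp: pseudo_convergent_def val_less_def gauge_def)

lemma gauge_strict_mono: "strict_mono gauge"
  by (simp add: strict_mono_Suc_iff gauge_Suc)

text \<open>Zero always lies in the breadth ideal, so the hypothesis yields a nonzero
  \<open>b\<close> in it, and \<open>v b\<close> bounds the increasing gauge from above.\<close>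

lemma gauge_convergent: "\<exists>L. gauge \<longlonglongrightarrow> L"
proof -
  have "0 \<in> breadth_ideal v s"
    using s_Suc_neq by (simp add: breadth_ideal_def val_less_def)
  then obtain b where "b \<in> breadth_ideal v s" "b \<noteq> 0"
    using breadth_nonzero by auto
  then have "gauge n \<le> v b" for n
    by (simp add: breadth_ideal_def val_less_def gauge_def less_imp_le)
  then show ?thesis
    using incseq_convergent[of gauge "v b"] strict_mono_mono[OF gauge_strict_mono] by blast
qed

lemma gauge_lim: "gauge \<longlonglongrightarrow> lim gauge"
  using gauge_convergent by (auto simp: convergent_LIMSEQ_iff[symmetric] convergent_def)


lemma u_s_Suc_diff: "u (to_ac (s (Suc n)) - to_ac (s n)) = gauge n"
  using u_to_ac[of "s (Suc n) - s n"] s_Suc_neq[of n] by (simp add: gauge_def)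

text \<open>In the telescoping sum for \<open>s n - s m\<close> the first increment has the smallest
  value, hence determines the value of the sum.\<close>

lemma s_diff:
  assumes "m < n"
  shows "s n \<noteq> s m \<and> u (to_ac (s n) - to_ac (s m)) = gauge m"
  using Suc_leI[OF assms]
proof (induction n rule: dec_induct)
  case base
  show ?case
    using s_Suc_neq u_s_Suc_diff by simp
next
  case (step n)
  let ?x = "to_ac (s n) - to_ac (s m)" and ?y = "to_ac (s (Suc n)) - to_ac (s n)"
  have "gauge m < gauge n"
    using step.hyps strict_monoD[OF gauge_strict_mono] by simp
  then have "val_less u ?x ?y"
    using step.IH u_s_Suc_diff[of n] by (simp add: val_less_def)
  from val_less_add[OF u_valuation this] show ?case
    using step.IH by simp
qed

section \<open>Distance of the sequence from a point of the algebraic closure\<close>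

lemma u_at_pseudo_limit:
  assumes "pseudo_limit u s \<alpha>"
  shows "to_ac (s n) \<noteq> \<alpha> \<and> u (to_ac (s n) - \<alpha>) = gauge n"
proof -
  \<comment> \<open>The sign is chosen so that the two arguments add up to the increment from
    \<open>s n\<close> to \<open>s (Suc n)\<close>.\<close>
  have less: "val_less u (\<alpha> - to_ac (s n)) (- (\<alpha> - to_ac (s (Suc n))))"
    using assms valuation_minus[OF u_valuation, of "\<alpha> - to_ac (s (Suc n))"]
    by (auto simp: pseudo_limit_def val_less_def)
  then have nz: "\<alpha> - to_ac (s n) \<noteq> 0"
    by (simp add: val_less_def)
  from val_less_add(2)[OF u_valuation less] have "u (\<alpha> - to_ac (s n)) = gauge n"
    using u_s_Suc_diff[of n] by simp
  then show ?thesis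
    using nz valuation_minus[OF u_valuation nz] by auto
qed

text \<open>Were all distances to \<alpha> equal to the gauge, \<alpha> would be a pseudo-limit. So
  this fails at some \<open>m\<close>; for \<open>n > m\<close>, \<open>s n - \<alpha>\<close> is
  the sum of \<open>s n - s m\<close>, of value \<open>gauge m\<close>, and
  \<open>s m - \<alpha>\<close>, and the smaller value prevails.\<close>

lemma u_at_non_pseudo_limit:
  assumes "\<not> pseudo_limit u s \<alpha>"
  shows "\<exists>c. \<forall>\<^sub>F n in sequentially. to_ac (s n) \<noteq> \<alpha> \<and> u (to_ac (s n) - \<alpha>) = c"
proof -
  have "\<exists>m. to_ac (s m) = \<alpha> \<or> u (to_ac (s m) - \<alpha>) \<noteq> gauge m"
  proof (rule ccontr)
    assume "\<not> ?thesis"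
    then have at: "to_ac (s n) \<noteq> \<alpha>" "u (to_ac (s n) - \<alpha>) = gauge n" for n
      by auto
    then have "\<alpha> - to_ac (s n) \<noteq> 0" "u (\<alpha> - to_ac (s n)) = gauge n" for n
      using valuation_minus[OF u_valuation, of "to_ac (s n) - \<alpha>"] by auto
    then have "pseudo_limit u s \<alpha>"
      using gauge_Suc by (auto simp: pseudo_limit_def val_less_def)
    with assms show False by simp
  qed
  then obtain m where m: "to_ac (s m) = \<alpha> \<or> u (to_ac (s m) - \<alpha>) \<noteq> gauge m"
    by blast
  let ?x = "to_ac (s m) - \<alpha>"
  have "\<exists>c. \<forall>n>m. to_ac (s n) \<noteq> \<alpha> \<and> u (to_ac (s n) - \<alpha>) = c"
  proof (cases "?x \<noteq> 0 \<and> u ?x < gauge m")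
    case True
    have "to_ac (s n) \<noteq> \<alpha> \<and> u (to_ac (s n) - \<alpha>) = u ?x" if "n > m" for n
    proof -
      have "val_less u ?x (to_ac (s n) - to_ac (s m))"
        using True s_diff[OF that] by (simp add: val_less_def)
      from val_less_add[OF u_valuation this] show ?thesis by simp
    qed
    then show ?thesis by blast
  next
    case False
    \<comment> \<open>By the choice of \<open>m\<close>, either \<open>?x\<close> is zero or its
      value strictly exceeds \<open>gauge m\<close>.\<close>
    have "to_ac (s n) \<noteq> \<alpha> \<and> u (to_ac (s n) - \<alpha>) = gauge m" if "n > m" for n
    proof -
      have "val_less u (to_ac (s n) - to_ac (s m)) ?x"
        using False m s_diff[OF that] by (auto simp: val_less_def)
      from val_less_add[OF u_valuation this] show ?thesis
        using s_diff[OF that] by simp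
    qed
    then show ?thesis by blast
  qed
  then show ?thesis
    by (auto simp: eventually_at_top_dense)
qed

section \<open>Eventual values of polynomials and rational functions\<close>

text \<open>Induction on the degree, removing one root at a time: a pseudo-limit raises the
  coefficient of \<open>gauge n\<close> by one, any other root only changes the constant.\<close>

lemma u_poly_eventually:
  assumes "p \<noteq> 0"
  shows "\<exists>c. \<forall>\<^sub>F n in sequentially. poly p (to_ac (s n)) \<noteq> 0 \<and>
    u (poly p (to_ac (s n))) = real (size (filter_mset (pseudo_limit u s) (proots p))) * gauge n + c"
    (is "\<exists>c. ?P p c")
  using assms
proof (induction "Polynomial.degree p" arbitrary: p)
  case 0
  then obtain a where "p = [:a:]" "a \<noteq> 0"
    by (metis degree_eq_zeroE pCons_0_0)
  then show ?case
    by (intro exI[of _ "u a"]) simp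
next
  case (Suc k)
  then obtain \<alpha> where "poly p \<alpha> = 0"
    using alg_closed_imp_poly_has_root[of p] by auto
  then obtain q where p: "p = [:- \<alpha>, 1:] * q"
    by (auto simp: poly_eq_0_iff_dvd)
  have q: "q \<noteq> 0"
    using Suc.prems p by auto
  have "Polynomial.degree p = Suc (Polynomial.degree q)"
    unfolding p using q by (subst degree_mult_eq) auto
  then obtain c where c: "?P q c"
    using Suc.hyps q by auto
  have proots: "proots p = add_mset \<alpha> (proots q)"
    unfolding p using q by (subst proots_mult) auto
  have u_p: "poly p (to_ac (s n)) \<noteq> 0 \<and>
      u (poly p (to_ac (s n))) = u (to_ac (s n) - \<alpha>) + u (poly q (to_ac (s n)))"
    if "to_ac (s n) \<noteq> \<alpha>" "poly q (to_ac (s n)) \<noteq> 0" for n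
    using that valuation_mult[OF u_valuation, of "to_ac (s n) - \<alpha>" "poly q (to_ac (s n))"]
    by (simp add: p algebra_simps)
  show ?case
  proof (cases "pseudo_limit u s \<alpha>")
    case True
    from c have "?P p c"
      by eventually_elim
        (use u_at_pseudo_limit[OF True] True in
          \<open>simp add: proots u_p algebra_simps\<close>)
    then show ?thesis ..
  next
    case False
    then obtain b where b: "\<forall>\<^sub>F n in sequentially.
        to_ac (s n) \<noteq> \<alpha> \<and> u (to_ac (s n) - \<alpha>) = b"
      using u_at_non_pseudo_limit by blast
    from c b have "?P p (b + c)"
      by eventually_elim
        (use False in \<open>simp add: proots u_p algebra_simps\<close>)
    then show ?thesis ..
  qed
qed

text \<open>At points of the base field the mapped polynomial takes values in the image of
  \<open>to_ac\<close>, where \<open>u\<close> restricts to \<open>v\<close>.\<close>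

lemma v_poly_eventually:
  assumes "p \<noteq> 0"
  shows "\<exists>c. \<forall>\<^sub>F n in sequentially. poly p (s n) \<noteq> 0 \<and>
    v (poly p (s n)) = real (pseudo_limit_roots u s p) * gauge n + c"
proof -
  from u_poly_eventually[of "map_poly to_ac p"] assms
  obtain c where "\<forall>\<^sub>F n in sequentially. to_ac (poly p (s n)) \<noteq> 0 \<and>
      u (to_ac (poly p (s n))) = real (pseudo_limit_roots u s p) * gauge n + c"
    by (auto simp: pseudo_limit_roots_eq_size poly_map_poly_to_ac)
  then have "\<forall>\<^sub>F n in sequentially. poly p (s n) \<noteq> 0 \<and>
      v (poly p (s n)) = real (pseudo_limit_roots u s p) * gauge n + c"
    by eventually_elim (auto simp: u_to_ac)
  then show ?thesis ..
qed

lemma denom_eventually: "\<forall>\<^sub>F n in sequentially. poly (denom \<phi>) (s n) \<noteq> 0"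
  using v_poly_eventually[OF denom_nonzero[of \<phi>]] by (auto elim: eventually_mono)

lemma v_ratfun_eventually:
  assumes "\<phi> \<noteq> 0"
  shows "\<exists>c. \<forall>\<^sub>F n in sequentially. ratfun_eval \<phi> (s n) \<noteq> 0 \<and>
    v (ratfun_eval \<phi> (s n)) = real_of_int (degdom u s \<phi>) * gauge n + c"
proof -
  have "numer \<phi> \<noteq> 0"
    using assms by (simp add: numer_eq_0_iff)
  then obtain a where a: "\<forall>\<^sub>F n in sequentially. poly (numer \<phi>) (s n) \<noteq> 0 \<and>
      v (poly (numer \<phi>) (s n)) = real (pseudo_limit_roots u s (numer \<phi>)) * gauge n + a"
    using v_poly_eventually by blast
  obtain b where b: "\<forall>\<^sub>F n in sequentially. poly (denom \<phi>) (s n) \<noteq> 0 \<and>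
      v (poly (denom \<phi>) (s n)) = real (pseudo_limit_roots u s (denom \<phi>)) * gauge n + b"
    using v_poly_eventually[OF denom_nonzero] by blast
  from a b have "\<forall>\<^sub>F n in sequentially. ratfun_eval \<phi> (s n) \<noteq> 0 \<and>
      v (ratfun_eval \<phi> (s n)) = real_of_int (degdom u s \<phi>) * gauge n + (a - b)"
    by eventually_elim (simp add: ratfun_eval_def v_divide degdom_def algebra_simps)
  then show ?thesis ..
qed

text \<open>This is the intercept of the eventual affine form, recovered from its limit
  \<open>w_E v s \<phi>\<close> and its slope.\<close>

definition const_term :: "'a poly fract \<Rightarrow> real" where
  "const_term \<phi> = w_E v s \<phi> - real_of_int (degdom u s \<phi>) * lim gauge"

lemma v_ratfun:
  assumes "\<phi> \<noteq> 0"
  shows "\<forall>\<^sub>F n in sequentially. ratfun_eval \<phi> (s n) \<noteq> 0 \<and>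
    v (ratfun_eval \<phi> (s n)) = real_of_int (degdom u s \<phi>) * gauge n + const_term \<phi>"
proof -
  let ?d = "real_of_int (degdom u s \<phi>)"
  obtain c where c: "\<forall>\<^sub>F n in sequentially. ratfun_eval \<phi> (s n) \<noteq> 0 \<and>
      v (ratfun_eval \<phi> (s n)) = ?d * gauge n + c"
    using v_ratfun_eventually[OF assms] by blast
  have "(\<lambda>n. ?d * gauge n + c) \<longlonglongrightarrow> ?d * lim gauge + c"
    by (intro tendsto_intros gauge_lim)
  \<comment> \<open>Agreement for almost all \<open>n\<close> transfers the limit; this also shows
    that the limit defining \<open>w_E\<close> exists.\<close>
  then have "(\<lambda>n. v (ratfun_eval \<phi> (s n))) \<longlonglongrightarrow> ?d * lim gauge + c"
    by (rule Lim_transform_eventually) (use c in \<open>auto elim: eventually_mono\<close>)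
  then have "w_E v s \<phi> = ?d * lim gauge + c"
    unfolding w_E_def by (rule limI)
  with c show ?thesis
    by (simp add: const_term_def)
qed

section \<open>The valuation and its ring\<close>

definition \<nu> :: "'a poly fract \<Rightarrow> real \<times> real" where
  "\<nu> \<phi> = (w_E v s \<phi>, - real_of_int (degdom u s \<phi>))"

text \<open>This reduces the lexicographic order to termwise comparison along the sequence, so that
  the laws of \<open>v\<close> can be applied at each \<open>s n\<close>.\<close>

lemma \<nu>_le_iff:
  assumes "\<phi> \<noteq> 0" "\<psi> \<noteq> 0"
  shows "\<nu> \<phi> \<le> \<nu> \<psi> \<longleftrightarrow>
    (\<forall>\<^sub>F n in sequentially. v (ratfun_eval \<phi> (s n)) \<le> v (ratfun_eval \<psi> (s n)))"
proof -
  have "\<nu> \<phi> \<le> \<nu> \<psi> \<longleftrightarrow> (\<forall>\<^sub>F n in sequentially.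
      real_of_int (degdom u s \<phi>) * gauge n + const_term \<phi> \<le>
      real_of_int (degdom u s \<psi>) * gauge n + const_term \<psi>)"
    using eventually_affine_le_iff[OF gauge_strict_mono gauge_lim]
    by (simp add: \<nu>_def const_term_def)
  also have "\<dots> \<longleftrightarrow>
      (\<forall>\<^sub>F n in sequentially. v (ratfun_eval \<phi> (s n)) \<le> v (ratfun_eval \<psi> (s n)))"
    by (rule eventually_cong[OF eventually_conj[OF v_ratfun[OF assms(1)] v_ratfun[OF assms(2)]]])
      auto
  finally show ?thesis .
qed

lemma \<nu>_nonneg_iff:
  assumes "\<phi> \<noteq> 0"
  shows "0 \<le> \<nu> \<phi> \<longleftrightarrow> (\<forall>\<^sub>F n in sequentially. 0 \<le> v (ratfun_eval \<phi> (s n)))"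
proof -
  have "0 \<le> \<nu> \<phi> \<longleftrightarrow> (\<forall>\<^sub>F n in sequentially.
      0 \<le> real_of_int (degdom u s \<phi>) * gauge n + const_term \<phi>)"
    using eventually_affine_nonneg_iff[OF gauge_strict_mono gauge_lim]
    by (simp add: \<nu>_def const_term_def)
  also have "\<dots> \<longleftrightarrow> (\<forall>\<^sub>F n in sequentially. 0 \<le> v (ratfun_eval \<phi> (s n)))"
    by (rule eventually_cong[OF v_ratfun[OF assms]]) auto
  finally show ?thesis .
qed

text \<open>Additivity of \<open>v\<close> at each \<open>s n\<close> makes two affine functions of
  the gauge eventually equal. Their slopes and limits then agree, which gives additivity of
  \<open>degdom\<close> and \<open>w_E\<close> together.\<close>

lemma \<nu>_mult:
  assumes "\<phi> \<noteq> 0" "\<psi> \<noteq> 0"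
  shows "\<nu> (\<phi> * \<psi>) = \<nu> \<phi> + \<nu> \<psi>"
proof -
  let ?d = "real_of_int (degdom u s \<phi>) + real_of_int (degdom u s \<psi>)"
  let ?e = "real_of_int (degdom u s (\<phi> * \<psi>))"
  let ?c = "const_term \<phi> + const_term \<psi>"
  have "\<phi> * \<psi> \<noteq> 0"
    using assms by simp
  from v_ratfun[OF this]
  have "\<forall>\<^sub>F n in sequentially. ?e * gauge n + const_term (\<phi> * \<psi>) = ?d * gauge n + ?c"
    using v_ratfun[OF assms(1)] v_ratfun[OF assms(2)]
      denom_eventually[of \<phi>] denom_eventually[of \<psi>] denom_eventually[of "\<phi> * \<psi>"]
  proof eventually_elim
    case (elim n)
    then show ?case
      using assms v_mult[of "ratfun_eval \<phi> (s n)" "ratfun_eval \<psi> (s n)"]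
      by (simp add: ratfun_eval_mult algebra_simps)
  qed
  \<comment> \<open>Eventual equality gives eventual inequalities both ways; antisymmetry of the
    lexicographic order identifies the pairs.\<close>
  then have "(?e * lim gauge + const_term (\<phi> * \<psi>), - ?e) = (?d * lim gauge + ?c, - ?d)"
    by (intro antisym eventually_affine_le_iff[OF gauge_strict_mono gauge_lim, THEN iffD1])
      (auto elim: eventually_mono)
  then show ?thesis
    by (simp add: \<nu>_def const_term_def algebra_simps)
qed

text \<open>Fixing which value is smaller lets the ultrametric inequality for \<open>v\<close> be
  used with the same minimum at almost all \<open>n\<close>.\<close>

lemma \<nu>_add:
  assumes "\<phi> \<noteq> 0" "\<psi> \<noteq> 0" "\<phi> + \<psi> \<noteq> 0" "\<nu> \<phi> \<le> \<nu> \<psi>"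
  shows "\<nu> \<phi> \<le> \<nu> (\<phi> + \<psi>)"
proof -
  have "\<forall>\<^sub>F n in sequentially. v (ratfun_eval \<phi> (s n)) \<le> v (ratfun_eval \<psi> (s n))"
    using assms by (simp add: \<nu>_le_iff)
  then have "\<forall>\<^sub>F n in sequentially. v (ratfun_eval \<phi> (s n)) \<le> v (ratfun_eval (\<phi> + \<psi>) (s n))"
    using v_ratfun[OF assms(1)] v_ratfun[OF assms(2)] v_ratfun[OF assms(3)]
      denom_eventually[of \<phi>] denom_eventually[of \<psi>] denom_eventually[of "\<phi> + \<psi>"]
  proof eventually_elim
    case (elim n)
    then show ?case
      using v_add[of "ratfun_eval \<phi> (s n)" "ratfun_eval \<psi> (s n)"]
      by (simp add: ratfun_eval_add)
  qed
  then show ?thesis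
    using assms by (simp add: \<nu>_le_iff)
qed

lemma \<nu>_valuation: "valuation \<nu>"
  unfolding valuation_def
proof (intro conjI allI impI)
  fix \<phi> \<psi> :: "'a poly fract"
  assume nz: "\<phi> \<noteq> 0" "\<psi> \<noteq> 0" "\<phi> + \<psi> \<noteq> 0"
  show "min (\<nu> \<phi>) (\<nu> \<psi>) \<le> \<nu> (\<phi> + \<psi>)"
    using \<nu>_add[OF nz] \<nu>_add[of \<psi> \<phi>] nz by (cases "\<nu> \<phi> \<le> \<nu> \<psi>") (auto simp: add.commute)
qed (rule \<nu>_mult)

lemma \<nu>_valuation_ring: "valuation_ring \<nu> = V_E (valuation_ring v) s"
proof -
  have "\<phi> \<in> valuation_ring \<nu> \<longleftrightarrow> \<phi> \<in> V_E (valuation_ring v) s" for \<phi>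
  proof (cases "\<phi> = 0")
    case True
    then have "ratfun_eval \<phi> x = 0" for x
      using numer_eq_0_iff[of \<phi>] by (simp add: ratfun_eval_def)
    with True denom_eventually[of \<phi>] show ?thesis
      by (simp add: valuation_ring_def V_E_def)
  next
    case False
    have "(\<forall>\<^sub>F n in sequentially. 0 \<le> v (ratfun_eval \<phi> (s n))) \<longleftrightarrow>
      (\<forall>\<^sub>F n in sequentially. poly (denom \<phi>) (s n) \<noteq> 0 \<and>
        ratfun_eval \<phi> (s n) \<in> valuation_ring v)"
      \<comment> \<open>For almost all \<open>n\<close> the denominator and the value at
        \<open>s n\<close> are nonzero, so membership in the ring of \<open>v\<close> means just a
        nonnegative value.\<close>
      by (rule eventually_cong[OF eventually_conj[OF denom_eventually[of \<phi>] v_ratfun[OF False]]])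
        (auto simp: valuation_ring_def)
    with False show ?thesis
      by (simp add: valuation_ring_def[of \<nu>] V_E_def \<nu>_nonneg_iff)
  qed
  then show ?thesis by blast
qed

end

theorem theorem4p10:
  fixes V :: "'a::field set"
    and v :: "'a \<Rightarrow> real"
    and u :: "'a alg_closure \<Rightarrow> real"
    and s :: "nat \<Rightarrow> 'a"
  defines "\<nu> \<equiv> (\<lambda>\<phi> :: 'a poly fract. (w_E v s \<phi>, - real_of_int (degdom u s \<phi>)))"
  assumes "valuation v"
    and "V = valuation_ring v"
    and "val_rank V = 1"
    and "extends_to_closure v u"
    and "pseudo_convergent v s"
    and "breadth_ideal v s \<noteq> {0}"
    and "val_rank (V_E V s) = 2"
  shows "valuation \<nu> \<and> valuation_ring \<nu> = V_E V s"
proof -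
  interpret bounded_pseudo_convergent v u s
    using assms by unfold_locales
  \<comment> \<open>The map fixed by \<open>defines\<close> is identified with the constant of the
    interpreted locale.\<close>
  have "\<nu> = local.\<nu>"
    by (simp add: assms(1) local.\<nu>_def fun_eq_iff)
  then show ?thesis
    using \<nu>_valuation \<nu>_valuation_ring assms(3) by simp
qed

end
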